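(* Let $X$ be a real vector space ordered by a cone $K$ and let $u\in K\setminus\{0\}$ be such that $K_u$ is Archimedean. Then the following assertions are equivalent. 1. $K(u)$ is $d$-complete. 2. $K(u)$ is self-complete in $X_u$. 3. $K_u$ is self-complete in $X_u$. 4. $(X_u,|\cdot|_u)$ is fundamentally $\sigma$-order complete. 5. $(X_u,|\cdot|_u)$ is monotonically sequentially complete. 6. $X_u$ is $|\cdot|_u$-complete. If, in addition, $K$ is Archimedean, then assertions 2 and 3 can be replaced by the stronger versions: 2$'$. $K(u)$ is self-complete in $X$. 3$'$. $K_u$ is self-complete in $X$.
   Context: A cone $K$ in a real vector space $X$ is a nonempty subset with $K+K\subset K$, $tK\subset K$ for all $t\ge 0$, and $K\cap(-K)=\{0\}$; it induces the order $x\le y\iff y-x\in K$, and $[x;y]_o=\{z: x\le z\le y\}$. A cone is Archimedean if, for its induced order, ($nx\le y$ for all $n\in\mathbb{N}$) implies $x\le 0$. Two elements $x,y\in K$ are linked ($x\sim y$) if there are $\lambda,\mu>0$ with $x\le\lambda y$ and $y\le\mu x$; the equivalence classes are called components, and $K(u)$ is the component of $u$. The Thompson metric is $d(x,y)=\inf\{s\ge 0: e^{-s}x\le y\le e^{s}x\}$ for $x,y\in K$, with $\inf\emptyset=\infty$. For $u\in K\setminus\{0\}$: $X_u=\bigcup_{\lambda\ge 0}\lambda[-u;u]_o$ (a vector subspace of $X$), $K_u=K\cap X_u$ (a cone in $X_u$, by which $X_u$ is ordered), and $|x|_u=\inf\{\lambda>0: x\in\lambda[-u;u]_o\}$ for $x\in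 X_u$ (a seminorm on $X_u$). $(X_u,|\cdot|_u)$ is fundamentally $\sigma$-order complete if every increasing $|\cdot|_u$-Cauchy sequence in $X_u$ has a supremum in $X_u$, and monotonically sequentially complete if every increasing $|\cdot|_u$-Cauchy sequence in $X_u$ is $|\cdot|_u$-convergent in $X_u$. A sequence $(x_n)$ in a cone is upper self-bounded if for every $\lambda>1$ there is $k\in\mathbb{N}$ with $x_n\le\lambda x_k$ for all $n\ge k$; lower self-bounded if for every $\mu\in(0,1)$ there is $k\in\mathbb{N}$ with $x_n\ge\mu x_k$ for all $n\ge k$; self-bounded if both. For $Z=X$ or $Z=X_u$, a nonempty subset $U$ of the cone of $Z$ is self-complete in $Z$ if every increasing self-bounded sequence in $U$ has a supremum in $Z$ that belongs to $U$, and every decreasing self-bounded sequence in $U$ has an infimum in $Z$ that belongs to $U$ (suprema and infima being computed in the ordered vector space $Z$). *)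

theory Defs
  imports Complex_Main "HOL-Library.Extended_Real"
begin

definition ordering_cone :: "'a::real_vector set \<Rightarrow> bool" where
  "ordering_cone K \<longleftrightarrow>
     K \<noteq> {} \<and>
     (\<forall>x\<in>K. \<forall>y\<in>K. x + y \<in> K) \<and>
     (\<forall>t\<ge>0. \<forall>x\<in>K. t *\<^sub>R x \<in> K) \<and>
     K \<inter> uminus ` K = {0}"

definition cone_le :: "'a::real_vector set \<Rightarrow> 'a \<Rightarrow> 'a \<Rightarrow> bool" where
  "cone_le K x y \<longleftrightarrow> y - x \<in> K"

definition order_interval :: "'a::real_vector set \<Rightarrow> 'a \<Rightarrow> 'a \<Rightarrow> 'a set" where
  "order_interval K x y = {z. cone_le K x z \<and> cone_le K z y}"

text \<open>
  In the definitions below, \<open>Z\<close> is a vector subspace of the ambient type and \<open>C\<close> a cone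
  in \<open>Z\<close>; the pair stands for the ordered vector space \<open>Z\<close> with positive cone \<open>C\<close>.
\<close>

definition archimedean_in :: "'a::real_vector set \<Rightarrow> 'a set \<Rightarrow> bool" where
  "archimedean_in Z C \<longleftrightarrow>
     (\<forall>x\<in>Z. \<forall>y\<in>Z. (\<forall>n::nat. cone_le C (real n *\<^sub>R x) y) \<longrightarrow> cone_le C x 0)"

definition is_sup_in :: "'a::real_vector set \<Rightarrow> 'a set \<Rightarrow> 'a set \<Rightarrow> 'a \<Rightarrow> bool" where
  "is_sup_in Z C S s \<longleftrightarrow>
     s \<in> Z \<and> (\<forall>x\<in>S. cone_le C x s) \<and>
     (\<forall>b\<in>Z. (\<forall>x\<in>S. cone_le C x b) \<longrightarrow> cone_le C s b)"

definition is_inf_in :: "'a::real_vector set \<Rightarrow> 'a set \<Rightarrow> 'a set \<Rightarrow> 'a \<Rightarrow> bool" where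
  "is_inf_in Z C S s \<longleftrightarrow>
     s \<in> Z \<and> (\<forall>x\<in>S. cone_le C s x) \<and>
     (\<forall>b\<in>Z. (\<forall>x\<in>S. cone_le C b x) \<longrightarrow> cone_le C b s)"

definition increasing_seq :: "'a::real_vector set \<Rightarrow> (nat \<Rightarrow> 'a) \<Rightarrow> bool" where
  "increasing_seq C x \<longleftrightarrow> monotone (\<le>) (cone_le C) x"

definition decreasing_seq :: "'a::real_vector set \<Rightarrow> (nat \<Rightarrow> 'a) \<Rightarrow> bool" where
  "decreasing_seq C x \<longleftrightarrow> monotone (\<le>) (\<lambda>a b. cone_le C b a) x"

definition upper_self_bounded :: "'a::real_vector set \<Rightarrow> (nat \<Rightarrow> 'a) \<Rightarrow> bool" where
  "upper_self_bounded C x \<longleftrightarrow> (\<forall>l>1. \<exists>k. \<forall>n\<ge>k. cone_le C (x n) (l *\<^sub>R x k))"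

definition lower_self_bounded :: "'a::real_vector set \<Rightarrow> (nat \<Rightarrow> 'a) \<Rightarrow> bool" where
  "lower_self_bounded C x \<longleftrightarrow>
     (\<forall>m. 0 < m \<and> m < 1 \<longrightarrow> (\<exists>k. \<forall>n\<ge>k. cone_le C (m *\<^sub>R x k) (x n)))"

definition self_bounded :: "'a::real_vector set \<Rightarrow> (nat \<Rightarrow> 'a) \<Rightarrow> bool" where
  "self_bounded C x \<longleftrightarrow> upper_self_bounded C x \<and> lower_self_bounded C x"

text \<open>Intended for nonempty \<open>U \<subseteq> C\<close>.\<close>

definition self_complete_in :: "'a::real_vector set \<Rightarrow> 'a set \<Rightarrow> 'a set \<Rightarrow> bool" where
  "self_complete_in Z C U \<longleftrightarrow>
     (\<forall>x. range x \<subseteq> U \<and> increasing_seq C x \<and> self_bounded C x \<longrightarrow>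
        (\<exists>s\<in>U. is_sup_in Z C (range x) s)) \<and>
     (\<forall>x. range x \<subseteq> U \<and> decreasing_seq C x \<and> self_bounded C x \<longrightarrow>
        (\<exists>s\<in>U. is_inf_in Z C (range x) s))"

definition linked :: "'a::real_vector set \<Rightarrow> 'a \<Rightarrow> 'a \<Rightarrow> bool" where
  "linked K x y \<longleftrightarrow>
     (\<exists>l>0. \<exists>m>0. cone_le K x (l *\<^sub>R y) \<and> cone_le K y (m *\<^sub>R x))"

definition cone_component :: "'a::real_vector set \<Rightarrow> 'a \<Rightarrow> 'a set" where
  "cone_component K u = {x \<in> K. linked K x u}"

text \<open>The infimum is taken in the extended reals, so that the infimum of the empty set is \<open>\<infinity>\<close>.\<close>

definition thompson :: "'a::real_vector set \<Rightarrow> 'a \<Rightarrow> 'a \<Rightarrow> ereal" where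
  "thompson K x y =
     Inf (ereal ` {s. 0 \<le> s \<and> cone_le K (exp (- s) *\<^sub>R x) y \<and> cone_le K y (exp s *\<^sub>R x)})"

definition order_span :: "'a::real_vector set \<Rightarrow> 'a \<Rightarrow> 'a set" where
  "order_span K u = (\<Union>l\<in>{0..}. (*\<^sub>R) l ` order_interval K (- u) u)"

definition order_span_cone :: "'a::real_vector set \<Rightarrow> 'a \<Rightarrow> 'a set" where
  "order_span_cone K u = K \<inter> order_span K u"

text \<open>
  Only meaningful for \<open>x \<in> order_span K u\<close>: otherwise this is the unspecified infimum of
  the empty set of reals.
\<close>

definition order_seminorm :: "'a::real_vector set \<Rightarrow> 'a \<Rightarrow> 'a \<Rightarrow> real" where
  "order_seminorm K u x = Inf {l. 0 < l \<and> x \<in> (*\<^sub>R) l ` order_interval K (- u) u}"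

definition order_seminorm_dist :: "'a::real_vector set \<Rightarrow> 'a \<Rightarrow> 'a \<Rightarrow> 'a \<Rightarrow> ereal" where
  "order_seminorm_dist K u x y = ereal (order_seminorm K u (x - y))"

text \<open>
  Cauchy sequences, convergence and completeness with respect to an extended-valued distance
  function. The metric spaces of the library are real-valued and
  require nonnegativity and symmetry on the whole type, so they do not apply directly.
\<close>

definition Cauchy_wrt :: "('a \<Rightarrow> 'a \<Rightarrow> ereal) \<Rightarrow> (nat \<Rightarrow> 'a) \<Rightarrow> bool" where
  "Cauchy_wrt D x \<longleftrightarrow> (\<forall>e::real. 0 < e \<longrightarrow> (\<exists>N. \<forall>m\<ge>N. \<forall>n\<ge>N. D (x m) (x n) < ereal e))"

definition converges_wrt :: "('a \<Rightarrow> 'a \<Rightarrow> ereal) \<Rightarrow> (nat \<Rightarrow> 'a) \<Rightarrow> 'a \<Rightarrow> bool" where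
  "converges_wrt D x l \<longleftrightarrow> (\<lambda>n. D (x n) l) \<longlonglongrightarrow> 0"

definition complete_wrt :: "('a \<Rightarrow> 'a \<Rightarrow> ereal) \<Rightarrow> 'a set \<Rightarrow> bool" where
  "complete_wrt D M \<longleftrightarrow>
     (\<forall>x. range x \<subseteq> M \<and> Cauchy_wrt D x \<longrightarrow> (\<exists>l\<in>M. converges_wrt D x l))"

definition fundamentally_sigma_order_complete ::
    "'a::real_vector set \<Rightarrow> 'a set \<Rightarrow> ('a \<Rightarrow> 'a \<Rightarrow> ereal) \<Rightarrow> bool" where
  "fundamentally_sigma_order_complete Z C D \<longleftrightarrow>
     (\<forall>x. range x \<subseteq> Z \<and> increasing_seq C x \<and> Cauchy_wrt D x \<longrightarrow>
        (\<exists>s. is_sup_in Z C (range x) s))"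

definition monotonically_sequentially_complete ::
    "'a::real_vector set \<Rightarrow> 'a set \<Rightarrow> ('a \<Rightarrow> 'a \<Rightarrow> ereal) \<Rightarrow> bool" where
  "monotonically_sequentially_complete Z C D \<longleftrightarrow>
     (\<forall>x. range x \<subseteq> Z \<and> increasing_seq C x \<and> Cauchy_wrt D x \<longrightarrow>
        (\<exists>l\<in>Z. converges_wrt D x l))"

end

theory Submission
  imports Defs
begin

text \<open>
  For sequences in \<open>K(u)\<close> that stay above a fixed positive multiple of \<open>u\<close>, Thompson closeness
  \<open>x \<le> (1 + e) y \<and> y \<le> (1 + e) x\<close> and norm closeness \<open>- e u \<le> x - y \<le> e u\<close> are uniformly
  equivalent; translating by a multiple of \<open>u\<close> moves any Cauchy sequence into that range, so
  \<open>1 \<longleftrightarrow> 6\<close>. A rapidly Cauchy sequence becomes increasing after subtracting a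
  suitable null sequence of multiples of \<open>u\<close>, which gives \<open>5 \<longrightarrow> 6\<close>. For increasing Cauchy
  sequences the Archimedean property identifies limits and suprema (\<open>4 \<longleftrightarrow> 5\<close>), and
  increasing or decreasing self-bounded sequences in \<open>K\<^sub>u\<close> are Cauchy, while increasing Cauchy
  sequences above \<open>u\<close> are self-bounded (\<open>5 \<longrightarrow> 3 \<longrightarrow> 2 \<longrightarrow> 4\<close>). These last implications work
  in any Archimedean subspace \<open>Z\<close> that contains \<open>X\<^sub>u\<close>; \<open>Z = X\<close> gives \<open>2'\<close> and \<open>3'\<close>.
\<close>

section \<open>Convergence for extended-valued distances\<close>

lemma tendsto_zero_ereal_iff:
  fixes f :: "nat \<Rightarrow> ereal"
  assumes "\<And>n. 0 \<le> f n"
  shows "f \<longlonglongrightarrow> 0 \<longleftrightarrow> (\<forall>e::real. 0 < e \<longrightarrow> (\<exists>N. \<forall>n\<ge>N. f n < ereal e))"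
proof
  assume f: "f \<longlonglongrightarrow> 0"
  show "\<forall>e::real. 0 < e \<longrightarrow> (\<exists>N. \<forall>n\<ge>N. f n < ereal e)"
    using order_tendstoD(2)[OF f] by (simp add: eventually_sequentially)
next
  assume small: "\<forall>e::real. 0 < e \<longrightarrow> (\<exists>N. \<forall>n\<ge>N. f n < ereal e)"
  show "f \<longlonglongrightarrow> 0"
  proof (rule order_tendstoI)
    fix a :: ereal
    assume "a < 0"
    then have "a < f n" for n
      using assms[of n] by (rule less_le_trans)
    then show "eventually (\<lambda>n. a < f n) sequentially" by simp
  next
    fix a :: ereal
    assume "0 < a"
    then obtain e where "0 < e" "ereal e < a"
      using ereal_dense2[of 0 a] by auto
    then show "eventually (\<lambda>n. f n < a) sequentially"
      using small unfolding eventually_sequentially by (meson less_trans)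
  qed
qed

text \<open>The inequalities \<open>Q e\<close> stand in for the distance \<open>D\<close> only up
  to a change of radius. This is enough for Cauchy sequences and limits, so that later arguments
  handle order inequalities instead of infima. Everything is relative to \<open>M\<close> because
  the seminorm has no meaning outside the span.\<close>

definition uniform_basis :: "('a \<Rightarrow> 'a \<Rightarrow> ereal) \<Rightarrow> (real \<Rightarrow> 'a \<Rightarrow> 'a \<Rightarrow> bool) \<Rightarrow> 'a set \<Rightarrow> bool" where
  "uniform_basis D Q M \<longleftrightarrow>
     (\<forall>x\<in>M. \<forall>y\<in>M. 0 \<le> D x y) \<and>
     (\<forall>e>0. \<exists>d>0. \<forall>x\<in>M. \<forall>y\<in>M. Q d x y \<longrightarrow> D x y < ereal e) \<and>
     (\<forall>e>0. \<exists>d>0. \<forall>x\<in>M. \<forall>y\<in>M. D x y < ereal d \<longrightarrow> Q e x y)"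

lemma Cauchy_wrt_iff:
  assumes "uniform_basis D Q M" and "\<And>n. x n \<in> M"
  shows "Cauchy_wrt D x \<longleftrightarrow> (\<forall>e>0. \<exists>N. \<forall>m\<ge>N. \<forall>n\<ge>N. Q e (x m) (x n))"
  using assms unfolding Cauchy_wrt_def uniform_basis_def by meson

lemma converges_wrt_iff:
  assumes "uniform_basis D Q M" and "\<And>n. x n \<in> M" and "l \<in> M"
  shows "converges_wrt D x l \<longleftrightarrow> (\<forall>e>0. \<exists>N. \<forall>n\<ge>N. Q e (x n) l)"
proof -
  have "converges_wrt D x l \<longleftrightarrow> (\<forall>e::real. 0 < e \<longrightarrow> (\<exists>N. \<forall>n\<ge>N. D (x n) l < ereal e))"
    unfolding converges_wrt_def using assms
    by (intro tendsto_zero_ereal_iff) (auto simp: uniform_basis_def)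
  then show ?thesis
    using assms unfolding uniform_basis_def by meson
qed

text \<open>Negation reverses the order and maps \<open>Z\<close> onto itself. Decreasing sequences
  can thus be treated through their increasing negatives.\<close>

lemma is_inf_in_iff_is_sup_in_uminus:
  assumes "subspace Z"
  shows "is_inf_in Z C (range x) s \<longleftrightarrow> is_sup_in Z C (range (\<lambda>n. - x n)) (- s)"
proof -
  have le: "cone_le C (- a) (- b) \<longleftrightarrow> cone_le C b a" for a b
    by (simp add: cone_le_def)
  have neg: "- a \<in> Z \<longleftrightarrow> a \<in> Z" for a
    using subspace_neg[OF assms, of a] subspace_neg[OF assms, of "- a"] by auto
  have "(\<forall>b\<in>Z. P b) \<longleftrightarrow> (\<forall>b\<in>Z. P (- b))" for P
    using neg by (metis minus_minus)
  from this[of "\<lambda>b. (\<forall>n. cone_le C (- x n) b) \<longrightarrow> cone_le C (- s) b"] show ?thesis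
    unfolding is_inf_in_def is_sup_in_def by (simp add: le neg)
qed

section \<open>The order induced by a cone\<close>

locale pointed_cone =
  fixes K :: "'a::real_vector set" and u :: 'a
  assumes cone: "ordering_cone K" and u_in_cone: "u \<in> K"
begin

abbreviation le (infix "\<preceq>" 50) where "le \<equiv> cone_le K"

lemma cone_add: "x \<in> K \<Longrightarrow> y \<in> K \<Longrightarrow> x + y \<in> K"
  and cone_scale: "0 \<le> t \<Longrightarrow> x \<in> K \<Longrightarrow> t *\<^sub>R x \<in> K"
  and cone_zero: "0 \<in> K"
  using cone unfolding ordering_cone_def by simp_all (metis IntD1 singletonI)

lemma le_refl [simp]: "x \<preceq> x"
  by (simp add: cone_le_def cone_zero)

lemma le_trans [trans]: "x \<preceq> y \<Longrightarrow> y \<preceq> z \<Longrightarrow> x \<preceq> z"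
  using cone_add[of "y - x" "z - y"] by (simp add: cone_le_def)

lemma le_add_mono: "x \<preceq> y \<Longrightarrow> z \<preceq> w \<Longrightarrow> x + z \<preceq> y + w"
  using cone_add[of "y - x" "w - z"] by (simp add: cone_le_def algebra_simps)

lemma le_scale_mono: "0 \<le> a \<Longrightarrow> x \<preceq> y \<Longrightarrow> a *\<^sub>R x \<preceq> a *\<^sub>R y"
  using cone_scale[of a "y - x"] by (simp add: cone_le_def algebra_simps)

lemma le_scale_right: "a \<le> b \<Longrightarrow> 0 \<preceq> x \<Longrightarrow> a *\<^sub>R x \<preceq> b *\<^sub>R x"
  using cone_scale[of "b - a" x] by (simp add: cone_le_def algebra_simps)

lemma le_diff_iff: "x - y \<preceq> z \<longleftrightarrow> x \<preceq> y + z"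
  by (simp add: cone_le_def algebra_simps)

lemma unit_nonneg: "0 \<preceq> u"
  using u_in_cone by (simp add: cone_le_def)

lemmas le_unit_scale = le_scale_right[OF _ unit_nonneg]

text \<open>For \<open>e >= 0\<close> this is membership of \<open>x - y\<close> in e[-u; u], that
  is, closeness in the seminorm with no infimum involved.\<close>

definition near :: "real \<Rightarrow> 'a \<Rightarrow> 'a \<Rightarrow> bool" where
  "near e x y \<longleftrightarrow> x \<preceq> y + e *\<^sub>R u \<and> y \<preceq> x + e *\<^sub>R u"

text \<open>This is Thompson closeness at radius \<open>ln (1 + e)\<close>. Writing
  \<open>1 + e\<close> for the exponential splits off an additive error, which can be compared with
  \<open>near\<close>.\<close>

definition close :: "real \<Rightarrow> 'a \<Rightarrow> 'a \<Rightarrow> bool" where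
  "close e x y \<longleftrightarrow> x \<preceq> (1 + e) *\<^sub>R y \<and> y \<preceq> (1 + e) *\<^sub>R x"

lemma near_mono: "near d x y \<Longrightarrow> d \<le> e \<Longrightarrow> near e x y"
  unfolding near_def by (meson le_add_mono le_refl le_trans le_unit_scale)

lemma near_sym: "near e x y \<longleftrightarrow> near e y x"
  by (auto simp: near_def)

lemma near_trans:
  assumes "near d x y" "near e y z"
  shows "near (d + e) x z"
proof -
  have "x \<preceq> y + d *\<^sub>R u" "y + d *\<^sub>R u \<preceq> z + e *\<^sub>R u + d *\<^sub>R u"
    "z \<preceq> y + e *\<^sub>R u" "y + e *\<^sub>R u \<preceq> x + d *\<^sub>R u + e *\<^sub>R u"
    using assms by (auto simp: near_def intro!: le_add_mono)
  then show ?thesis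
    unfolding near_def by (metis le_trans scaleR_add_left add.assoc add.commute)
qed

lemma near_iff_add: "near e (x + z) (y + z) \<longleftrightarrow> near e x y"
  by (simp add: near_def cone_le_def algebra_simps)

lemma near_iff_uminus: "near e (- x) (- y) \<longleftrightarrow> near e x y"
  by (auto simp: near_def cone_le_def algebra_simps)

lemma near_add:
  assumes "near d x y" "near e v w"
  shows "near (d + e) (x + v) (y + w)"
  using assms near_trans[of d "x + v" "y + v" e "y + w"] near_iff_add[of d x v y]
    near_iff_add[of e v y w] by (simp add: add.commute)

lemma near_shift_unit: "\<bar>t\<bar> \<le> e \<Longrightarrow> near e (x + t *\<^sub>R u) x"
  using le_unit_scale[of t e] le_unit_scale[of "- t" e]
  by (auto simp: near_def cone_le_def algebra_simps)

section \<open>The span and the component of \<open>u\<close>\<close>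

lemma mem_scaled_interval_iff:
  assumes "0 < l"
  shows "x \<in> (*\<^sub>R) l ` order_interval K (- u) u \<longleftrightarrow> near l x 0"
proof
  assume "x \<in> (*\<^sub>R) l ` order_interval K (- u) u"
  then obtain y where "- u \<preceq> y" "y \<preceq> u" "x = l *\<^sub>R y"
    by (auto simp: order_interval_def)
  with le_scale_mono[of l "- u" y] le_scale_mono[of l y u] assms show "near l x 0"
    by (simp add: near_def cone_le_def)
next
  assume near: "near l x 0"
  have "(1 / l) *\<^sub>R x \<in> order_interval K (- u) u"
    using near le_scale_mono[of "1 / l" x "l *\<^sub>R u"] le_scale_mono[of "1 / l" "0" "x + l *\<^sub>R u"] assms
    by (simp add: near_def cone_le_def order_interval_def algebra_simps)
  moreover have "x = l *\<^sub>R ((1 / l) *\<^sub>R x)" using assms by simp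
  ultimately show "x \<in> (*\<^sub>R) l ` order_interval K (- u) u" by blast
qed

lemma order_span_iff: "x \<in> order_span K u \<longleftrightarrow> (\<exists>l>0. near l x 0)"
proof
  assume "x \<in> order_span K u"
  then obtain l where l: "0 \<le> l" "x \<in> (*\<^sub>R) l ` order_interval K (- u) u"
    by (auto simp: order_span_def)
  show "\<exists>l>0. near l x 0"
  \<comment> \<open>The scale 0 is allowed in the definition of the span but not in that of the
    seminorm. It yields only the zero vector, which the scale 1 covers as well.\<close>
  proof (cases "l = 0")
    case True
    then have "x = 0" using l by auto
    then have "near 1 x 0" using unit_nonneg by (simp add: near_def)
    then show ?thesis by (intro exI[of _ 1]) simp
  next
    case False
    with l(1) have "0 < l" by simp
    then show ?thesis using l(2) mem_scaled_interval_iff by blast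
  qed
next
  assume "\<exists>l>0. near l x 0"
  then show "x \<in> order_span K u"
    using mem_scaled_interval_iff unfolding order_span_def by force
qed

lemma order_span_nearD: "near e x y \<Longrightarrow> y \<in> order_span K u \<Longrightarrow> x \<in> order_span K u"
  unfolding order_span_iff using near_trans[of e x y _ 0] near_mono
  by (metis dual_order.strict_trans1 less_add_one linear not_less)

lemma subspace_order_span: "subspace (order_span K u)"
proof (rule subspaceI)
  show "0 \<in> order_span K u"
    unfolding order_span_iff using unit_nonneg by (intro exI[of _ 1]) (simp add: near_def)
next
  fix x y assume "x \<in> order_span K u" "y \<in> order_span K u"
  then show "x + y \<in> order_span K u"
    unfolding order_span_iff using near_add[of _ x 0 _ y 0] by (metis add_0 add_pos_pos)
next
  fix c :: real and x assume "x \<in> order_span K u"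
  then obtain l where l: "0 < l" "near l x 0" unfolding order_span_iff by blast
  have pos: "near (c * l) (c *\<^sub>R x) 0" if "0 \<le> c" "near l x 0" for c x
    using that le_scale_mono[of c x "l *\<^sub>R u"] le_scale_mono[of c 0 "x + l *\<^sub>R u"]
    by (simp add: near_def algebra_simps)
  have "near (\<bar>c\<bar> * l) (c *\<^sub>R x) 0"
    using pos[of c x] pos[of "- c" "- x"] l near_iff_uminus[of l x 0] by (cases "0 \<le> c") auto
  \<comment> \<open>Adding 1 keeps the radius positive even for \<open>c = 0\<close>, as
    \<open>order_span_iff\<close> demands.\<close>
  then have "near (\<bar>c\<bar> * l + 1) (c *\<^sub>R x) 0" by (rule near_mono) simp
  moreover have "0 < \<bar>c\<bar> * l + 1" using l by (simp add: add_nonneg_pos)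
  ultimately show "c *\<^sub>R x \<in> order_span K u" unfolding order_span_iff by blast
qed

lemma unit_in_order_span: "u \<in> order_span K u"
  unfolding order_span_iff using near_shift_unit[of 1 1 0] by (intro exI[of _ 1]) simp

text \<open>The constant \<open>a\<close> is the reciprocal of a linking constant. Conversely, the
  lower bound by a multiple of \<open>u\<close> already forces \<open>x\<close> into the cone, since
  \<open>u\<close> is nonnegative.\<close>

lemma cone_component_iff:
  "x \<in> cone_component K u \<longleftrightarrow> (\<exists>a>0. \<exists>b>0. a *\<^sub>R u \<preceq> x \<and> x \<preceq> b *\<^sub>R u)"
proof
  assume "x \<in> cone_component K u"
  then obtain l m where *: "0 < l" "0 < m" "x \<preceq> l *\<^sub>R u" "u \<preceq> m *\<^sub>R x"
    by (auto simp: cone_component_def linked_def)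
  then have "(1 / m) *\<^sub>R u \<preceq> x"
    using le_scale_mono[of "1 / m" u "m *\<^sub>R x"] by simp
  with * show "\<exists>a>0. \<exists>b>0. a *\<^sub>R u \<preceq> x \<and> x \<preceq> b *\<^sub>R u"
    by (intro exI[of _ "1 / m"]) auto
next
  assume "\<exists>a>0. \<exists>b>0. a *\<^sub>R u \<preceq> x \<and> x \<preceq> b *\<^sub>R u"
  then obtain a b where *: "0 < a" "0 < b" "a *\<^sub>R u \<preceq> x" "x \<preceq> b *\<^sub>R u" by blast
  have "u \<preceq> (1 / a) *\<^sub>R x"
    using le_scale_mono[of "1 / a" "a *\<^sub>R u" x] * by simp
  moreover have "0 \<preceq> x"
    using le_trans[OF _ *(3), of 0] le_unit_scale[of 0 a] *(1) by simp
  moreover have "0 < 1 / a" using * by simp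
  ultimately show "x \<in> cone_component K u"
    using *(2,4) unfolding cone_component_def linked_def mem_Collect_eq
    by (metis cone_le_def diff_zero)
qed

lemma in_cone_iff: "x \<in> K \<longleftrightarrow> 0 \<preceq> x"
  by (simp add: cone_le_def)

lemma cone_component_subset: "cone_component K u \<subseteq> order_span_cone K u"
proof
  fix x assume x: "x \<in> cone_component K u"
  then obtain b where b: "0 < b" "x \<preceq> b *\<^sub>R u" unfolding cone_component_iff by blast
  moreover have K: "0 \<preceq> x" using x by (auto simp: cone_component_def in_cone_iff)
  moreover have "0 \<preceq> x + b *\<^sub>R u"
    using le_add_mono[OF K, of 0 "b *\<^sub>R u"] le_unit_scale[of 0 b] b by simp
  ultimately show "x \<in> order_span_cone K u"
    unfolding order_span_cone_def in_cone_iff Int_iff order_span_iff near_def by auto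
qed

lemma cone_component_in_span: "x \<in> cone_component K u \<Longrightarrow> x \<in> order_span K u"
  and cone_component_nonneg: "x \<in> cone_component K u \<Longrightarrow> 0 \<preceq> x"
  and order_span_cone_nonneg: "x \<in> order_span_cone K u \<Longrightarrow> 0 \<preceq> x"
  and order_span_cone_in_span: "x \<in> order_span_cone K u \<Longrightarrow> x \<in> order_span K u"
  using cone_component_subset by (auto simp: order_span_cone_def in_cone_iff)

lemma order_span_upper:
  assumes "x \<in> order_span K u"
  obtains b where "0 < b" "x \<preceq> b *\<^sub>R u"
  using assms unfolding order_span_iff near_def by auto

text \<open>Elements of the span lie below some multiple of \<open>u\<close> anyway, so only a
  positive lower bound has to be checked. This is how suprema and infima found in the cone of the
  span are placed in the component.\<close>

lemma order_span_lower_in_component: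
  assumes "s \<in> order_span K u" "t *\<^sub>R y \<preceq> s" "0 < t" "y \<in> cone_component K u"
  shows "s \<in> cone_component K u"
proof -
  obtain a where a: "0 < a" "a *\<^sub>R u \<preceq> y" using assms(4) unfolding cone_component_iff by blast
  then have "(t * a) *\<^sub>R u \<preceq> s"
    using le_trans[OF le_scale_mono[OF _ a(2), of t]] assms by simp
  moreover obtain b where "0 < b" "s \<preceq> b *\<^sub>R u" using order_span_upper[OF assms(1)] .
  ultimately show ?thesis unfolding cone_component_iff using a assms(3)
    by (metis mult_pos_pos)
qed

section \<open>The seminorm and the Thompson metric through order inequalities\<close>

lemma order_seminorm_lessI:
  assumes "near l x 0" "0 < l" "l < e"
  shows "order_seminorm K u x < e"
proof -
  have "order_seminorm K u x \<le> l"
    unfolding order_seminorm_def using assms mem_scaled_interval_iff[of l x]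
    by (intro cInf_lower) (auto intro!: bdd_belowI[of _ 0])
  with assms show ?thesis by simp
qed

lemma order_seminorm_set_nonempty:
  "x \<in> order_span K u \<Longrightarrow> {l. 0 < l \<and> x \<in> (*\<^sub>R) l ` order_interval K (- u) u} \<noteq> {}"
  using mem_scaled_interval_iff unfolding order_span_iff by blast

lemma order_seminorm_lessD:
  assumes "x \<in> order_span K u" "order_seminorm K u x < e"
  shows "near e x 0"
proof -
  obtain l where "0 < l" "x \<in> (*\<^sub>R) l ` order_interval K (- u) u" "l < e"
    using cInf_lessD[OF order_seminorm_set_nonempty[OF assms(1)] assms(2)[unfolded order_seminorm_def]]
    by blast
  then show ?thesis using mem_scaled_interval_iff[of l x] near_mono by auto
qed

lemma uniform_basis_order_seminorm:
  "uniform_basis (order_seminorm_dist K u) near (order_span K u)"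
proof -
  have near: "near e (x - y) 0 \<longleftrightarrow> near e x y" for e x y
    using near_iff_add[of e "x - y" y 0] by simp
  have span: "x - y \<in> order_span K u" if "x \<in> order_span K u" "y \<in> order_span K u" for x y
    using that by (rule subspace_diff[OF subspace_order_span])
  have "0 \<le> order_seminorm K u x" if "x \<in> order_span K u" for x
    unfolding order_seminorm_def
    by (intro cInf_greatest order_seminorm_set_nonempty that) auto
  \<comment> \<open>Membership at radius \<open>e / 2\<close> bounds the infimum by
    \<open>e / 2\<close>, which gives the strict inequality required.\<close>
  moreover have "order_seminorm K u (x - y) < e" if "near (e / 2) x y" "0 < e" for x y e
    by (rule order_seminorm_lessI[of "e / 2"]) (use that near in auto)
  moreover have "near e x y"
    if "x \<in> order_span K u" "y \<in> order_span K u" "order_seminorm K u (x - y) < e" for x y e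
    using order_seminorm_lessD[OF span] that near by blast
  ultimately show ?thesis
    unfolding uniform_basis_def order_seminorm_dist_def using span
    by (auto intro: exI[of _ "_ / 2"])
qed

lemma close_mono: "close d x y \<Longrightarrow> d \<le> e \<Longrightarrow> 0 \<preceq> x \<Longrightarrow> 0 \<preceq> y \<Longrightarrow> close e x y"
  unfolding close_def by (meson add_left_mono le_scale_right le_trans)

lemma uniform_basis_thompson: "uniform_basis (thompson K) close (cone_component K u)"
proof -
  \<comment> \<open>Multiplying by \<open>exp s\<close> turns the lower Thompson bound into an upper
    one, so both bounds together become \<open>close (exp s - 1)\<close>.\<close>
  have exp_le: "exp (- s) *\<^sub>R x \<preceq> y \<longleftrightarrow> x \<preceq> exp s *\<^sub>R y" for s x y
    using le_scale_mono[of "exp s" "exp (- s) *\<^sub>R x" y] le_scale_mono[of "exp (- s)" x "exp s *\<^sub>R y"]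
    by (auto simp: exp_minus)
  have less_iff: "thompson K x y < ereal e \<longleftrightarrow> (\<exists>s\<ge>0. s < e \<and> close (exp s - 1) x y)" for x y e
    unfolding thompson_def Inf_less_iff by (auto simp: close_def exp_le)
  have nonneg: "0 \<le> thompson K x y" for x y
    unfolding thompson_def by (auto intro!: Inf_greatest)
  have "\<exists>d>0. \<forall>x\<in>cone_component K u. \<forall>y\<in>cone_component K u.
      close d x y \<longrightarrow> thompson K x y < ereal e" if "0 < e" for e
    \<comment> \<open>The exponent \<open>s = e / 2\<close> lies strictly below \<open>e\<close> and
      determines the radius.\<close>
    using that unfolding less_iff
    by (intro exI[of _ "exp (e / 2) - 1"]) (auto intro!: exI[of _ "e / 2"])
  moreover have "\<exists>d>0. \<forall>x\<in>cone_component K u. \<forall>y\<in>cone_component K u.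
      thompson K x y < ereal d \<longrightarrow> close e x y" if "0 < e" for e
  \<comment> \<open>This is the exponent at which \<open>exp s - 1\<close> reaches
    \<open>e\<close>.\<close>
  proof (intro exI[of _ "ln (1 + e)"] conjI ballI impI)
    show "0 < ln (1 + e)" using that by simp
    fix x y assume xy: "x \<in> cone_component K u" "y \<in> cone_component K u"
      and "thompson K x y < ereal (ln (1 + e))"
    then obtain s where s: "s < ln (1 + e)" "close (exp s - 1) x y" unfolding less_iff by blast
    then have "exp s < 1 + e" using that by (metis add_pos_pos exp_less_mono exp_ln zero_less_one)
    then show "close e x y"
      using close_mono[OF s(2)] xy cone_component_nonneg by simp
  qed
  ultimately show ?thesis unfolding uniform_basis_def using nonneg by blast
qed

section \<open>Cauchy sequences and completeness in terms of inequalities\<close>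

definition near_Cauchy :: "(nat \<Rightarrow> 'a) \<Rightarrow> bool" where
  "near_Cauchy x \<longleftrightarrow> (\<forall>e>0. \<exists>N. \<forall>m\<ge>N. \<forall>n\<ge>N. near e (x m) (x n))"

definition near_tendsto :: "(nat \<Rightarrow> 'a) \<Rightarrow> 'a \<Rightarrow> bool" where
  "near_tendsto x l \<longleftrightarrow> (\<forall>e>0. \<exists>N. \<forall>n\<ge>N. near e (x n) l)"

lemmas seminorm_Cauchy_iff =
  Cauchy_wrt_iff[OF uniform_basis_order_seminorm, folded near_Cauchy_def]
lemmas seminorm_converges_iff =
  converges_wrt_iff[OF uniform_basis_order_seminorm, folded near_tendsto_def]
lemmas thompson_Cauchy_iff = Cauchy_wrt_iff[OF uniform_basis_thompson]
lemmas thompson_converges_iff = converges_wrt_iff[OF uniform_basis_thompson]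

abbreviation span_complete where
  "span_complete \<equiv> complete_wrt (order_seminorm_dist K u) (order_span K u)"

abbreviation span_mono_complete where
  "span_mono_complete \<equiv> monotonically_sequentially_complete
     (order_span K u) (order_span_cone K u) (order_seminorm_dist K u)"

abbreviation span_sigma_complete where
  "span_sigma_complete \<equiv> fundamentally_sigma_order_complete
     (order_span K u) (order_span_cone K u) (order_seminorm_dist K u)"

abbreviation component_complete where
  "component_complete \<equiv> complete_wrt (thompson K) (cone_component K u)"

text \<open>The limit need not be placed in the span beforehand: some term of the sequence is within
  1 of it, and \<open>order_span_nearD\<close> does the rest.\<close>

lemma span_completeI:
  assumes "\<And>x. (\<And>n. x n \<in> order_span K u) \<Longrightarrow> near_Cauchy x \<Longrightarrow> \<exists>l. near_tendsto x l"
  shows span_complete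
  unfolding complete_wrt_def
proof (intro allI impI)
  fix x assume "range x \<subseteq> order_span K u \<and> Cauchy_wrt (order_seminorm_dist K u) x"
  then have x: "x n \<in> order_span K u" and "Cauchy_wrt (order_seminorm_dist K u) x" for n by auto
  then obtain l where l: "near_tendsto x l" using assms seminorm_Cauchy_iff by blast
  then obtain n where "near 1 (x n) l" unfolding near_tendsto_def by (meson order_refl zero_less_one)
  then have "l \<in> order_span K u" using order_span_nearD near_sym x by blast
  then show "\<exists>l\<in>order_span K u. converges_wrt (order_seminorm_dist K u) x l"
    using l seminorm_converges_iff x by blast
qed

lemma span_completeD:
  assumes span_complete "\<And>n. x n \<in> order_span K u" "near_Cauchy x"
  obtains l where "l \<in> order_span K u" "near_tendsto x l"
proof -
  have "range x \<subseteq> order_span K u" "Cauchy_wrt (order_seminorm_dist K u) x"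
    using assms seminorm_Cauchy_iff by auto
  then obtain l where "l \<in> order_span K u" "converges_wrt (order_seminorm_dist K u) x l"
    using assms(1) unfolding complete_wrt_def by blast
  then show ?thesis using that seminorm_converges_iff assms(2) by blast
qed

text \<open>An upper bound \<open>b\<close> turns the relative error \<open>e / b\<close> into an
  absolute one: if w <= b u, then (e / b) w <= e u.\<close>

lemma close_imp_near:
  assumes "close (e / b) x y" "x \<preceq> b *\<^sub>R u" "y \<preceq> b *\<^sub>R u" "0 < e" "0 < b"
  shows "near e x y"
proof -
  have "v \<preceq> w + e *\<^sub>R u" if "v \<preceq> (1 + e / b) *\<^sub>R w" "w \<preceq> b *\<^sub>R u" for v w
  proof -
    have "w + (e / b) *\<^sub>R w \<preceq> w + (e / b) *\<^sub>R (b *\<^sub>R u)"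
      using that assms by (intro le_add_mono le_scale_mono) auto
    with that(1) show ?thesis
      using assms by (auto simp: scaleR_add_left intro: le_trans)
  qed
  then show ?thesis using assms unfolding near_def close_def by auto
qed

text \<open>A lower bound \<open>a\<close> turns the absolute error \<open>e * a\<close> into a
  relative one: if a u <= w, then e a u <= e w.\<close>

lemma near_imp_close:
  assumes "near (e * a) x y" "a *\<^sub>R u \<preceq> x" "a *\<^sub>R u \<preceq> y" "0 < e" 
  shows "close e x y"
proof -
  have "v \<preceq> (1 + e) *\<^sub>R w" if "v \<preceq> w + (e * a) *\<^sub>R u" "a *\<^sub>R u \<preceq> w" for v w
  proof -
    have "w + e *\<^sub>R (a *\<^sub>R u) \<preceq> w + e *\<^sub>R w"
      using that assms by (intro le_add_mono le_scale_mono) auto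
    with that(1) show ?thesis
      by (auto simp: scaleR_add_left intro: le_trans)
  qed
  then show ?thesis using assms unfolding near_def close_def by auto
qed

section \<open>Completeness of the component against completeness of the span\<close>

lemma component_complete_imp_span_complete:
  assumes component_complete
  shows span_complete
proof (rule span_completeI)
  fix x assume x: "\<And>n. x n \<in> order_span K u" and Cauchy: "near_Cauchy x"
  obtain N where N: "near 1 (x m) (x n)" if "m \<ge> N" "n \<ge> N" for m n
    using Cauchy unfolding near_Cauchy_def by (meson zero_less_one)
  obtain M where M: "0 < M" "near M (x N) 0" using x[of N] order_span_iff by blast
  \<comment> \<open>From index \<open>N\<close> on the radii 1 and \<open>M\<close> add up, so the
    terms are at least -(1 + M) u. Shifting by \<open>M + 2\<close> lifts them above
    \<open>u\<close> itself; the index shift drops the earlier terms.\<close>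
  define y where "y n = x (n + N) + (M + 2) *\<^sub>R u" for n
  have bounded: "near (1 + M) (x (n + N)) 0" for n
    using near_trans[OF N M(2)] by simp
  have lower: "1 *\<^sub>R u \<preceq> y n" for n
    using bounded[of n] by (simp add: y_def near_def cone_le_def algebra_simps scaleR_2)
  have upper: "y n \<preceq> (2 * M + 3) *\<^sub>R u" for n
  proof -
    have "y n \<preceq> (1 + M) *\<^sub>R u + (M + 2) *\<^sub>R u"
      using bounded[of n] unfolding y_def by (intro le_add_mono) (simp_all add: near_def)
    moreover have "(1 + M) + (M + 2) = 2 * M + 3" by simp
    ultimately show ?thesis by (metis scaleR_add_left)
  qed
  have y: "y n \<in> cone_component K u" for n
    unfolding cone_component_iff using lower[of n] upper[of n] M
    by (intro exI[of _ 1] conjI exI[of _ "2 * M + 3"]) auto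
  have "\<exists>N. \<forall>m\<ge>N. \<forall>n\<ge>N. close e (y m) (y n)" if "0 < e" for e
  proof -
    obtain N' where "near e (x m) (x n)" if "m \<ge> N'" "n \<ge> N'" for m n
      using Cauchy \<open>0 < e\<close> unfolding near_Cauchy_def by blast
    then have "near e (y m) (y n)" if "m \<ge> N'" "n \<ge> N'" for m n
      using that by (simp add: y_def near_iff_add)
    \<comment> \<open>Since the lower bound is \<open>u\<close> with coefficient 1, the absolute and
      the relative radius agree.\<close>
    then show ?thesis using near_imp_close[OF _ lower lower \<open>0 < e\<close>] by (metis mult_1_right)
  qed
  then have "Cauchy_wrt (thompson K) y" using thompson_Cauchy_iff y by blast
  then obtain l where l: "l \<in> cone_component K u" "converges_wrt (thompson K) y l"
    using assms y unfolding complete_wrt_def by (metis image_subsetI)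
  obtain c where c: "0 < c" "l \<preceq> c *\<^sub>R u" using l(1) unfolding cone_component_iff by blast
  \<comment> \<open>One multiple of \<open>u\<close> has to dominate the limit and all terms before
    a relative error can be read as an absolute one.\<close>
  define b where "b = max c (2 * M + 3)"
  have b: "0 < b" "l \<preceq> b *\<^sub>R u" "y n \<preceq> b *\<^sub>R u" for n
    using c(1) le_trans[OF c(2) le_unit_scale] le_trans[OF upper le_unit_scale]
    by (auto simp: b_def)
  have "near_tendsto x (l - (M + 2) *\<^sub>R u)"
    unfolding near_tendsto_def
  proof (intro allI impI)
    fix e :: real assume "0 < e"
    then obtain N' where "close (e / b) (y n) l" if "n \<ge> N'" for n
      using l thompson_converges_iff[of y l] y b(1) by (metis divide_pos_pos)
    then have "near e (y n) l" if "n \<ge> N'" for n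
      using close_imp_near b \<open>0 < e\<close> that by blast
    then have "near e (x (n + N)) (l - (M + 2) *\<^sub>R u)" if "n \<ge> N'" for n
      using that near_iff_add[of e "x (n + N)" "(M + 2) *\<^sub>R u" "l - (M + 2) *\<^sub>R u"]
      by (simp add: y_def)
    then have "near e (x n) (l - (M + 2) *\<^sub>R u)" if "n \<ge> N' + N" for n
      using that by (metis add_le_imp_le_diff add_leD2 le_add_diff_inverse2)
    then show "\<exists>N. \<forall>n\<ge>N. near e (x n) (l - (M + 2) *\<^sub>R u)" by blast
  qed
  then show "\<exists>l. near_tendsto x l" by blast
qed

lemma span_complete_imp_component_complete:
  assumes span_complete
  shows component_complete
  unfolding complete_wrt_def
proof (intro allI impI)
  fix x assume "range x \<subseteq> cone_component K u \<and> Cauchy_wrt (thompson K) x"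
  then have x: "x n \<in> cone_component K u" and "Cauchy_wrt (thompson K) x" for n by auto
  then have Cauchy: "\<exists>N. \<forall>m\<ge>N. \<forall>n\<ge>N. close e (x m) (x n)" if "0 < e" for e
    using thompson_Cauchy_iff that by blast
  obtain N where N: "close 1 (x m) (x n)" if "m \<ge> N" "n \<ge> N" for m n
    using Cauchy[of 1] by auto
  obtain a b where ab: "0 < a" "0 < b" "a *\<^sub>R u \<preceq> x N" "x N \<preceq> b *\<^sub>R u"
    using x[of N] unfolding cone_component_iff by blast
  \<comment> \<open>The factor 2 in \<open>close 1\<close> doubles the upper bound of
    \<open>x N\<close> and, below, halves its lower bound.\<close>
  have upper: "x n \<preceq> (2 * b) *\<^sub>R u" if "n \<ge> N" for n
    using N[of n N] le_scale_mono[OF _ ab(4), of 2] that by (auto simp: close_def intro: le_trans)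
  have lower: "(a / 2) *\<^sub>R u \<preceq> x n" if "n \<ge> N" for n
    using le_scale_mono[of "1 / 2" "a *\<^sub>R u" "2 *\<^sub>R x n"] N[of N n] ab(3) that
    by (auto simp: close_def intro: le_trans)
  have "near_Cauchy x"
    unfolding near_Cauchy_def
  proof (intro allI impI)
    fix e :: real assume "0 < e"
    then obtain N' where N': "close (e / (2 * b)) (x m) (x n)" if "m \<ge> N'" "n \<ge> N'" for m n
      using Cauchy[of "e / (2 * b)"] ab by auto
    then have "near e (x m) (x n)" if "m \<ge> max N N'" "n \<ge> max N N'" for m n
      using close_imp_near[OF N' upper upper \<open>0 < e\<close>] that ab by auto
    then show "\<exists>N. \<forall>m\<ge>N. \<forall>n\<ge>N. near e (x m) (x n)" by blast
  qed
  then obtain l where l: "l \<in> order_span K u" "near_tendsto x l"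
    using span_completeD[OF assms] x cone_component_in_span by metis
  \<comment> \<open>With an error of \<open>a / 4\<close>, the limit keeps \<open>a / 4\<close> of
    the lower bound \<open>a / 2\<close>. This positive remainder places it in the
    component.\<close>
  obtain N' where N': "near (a / 4) (x n) l" if "n \<ge> N'" for n
    using l(2) ab(1) unfolding near_tendsto_def by (metis divide_pos_pos zero_less_numeral)
  have "(a / 2) *\<^sub>R u \<preceq> l + (a / 4) *\<^sub>R u"
    using le_trans[OF lower, of "max N N'"] N'[of "max N N'"] by (auto simp: near_def)
  moreover have "(a / 2) *\<^sub>R u = (a / 4) *\<^sub>R u + (a / 4) *\<^sub>R u"
    by (simp flip: scaleR_add_left)
  ultimately have l_lower: "(a / 4) *\<^sub>R u \<preceq> l"
    by (simp add: cone_le_def algebra_simps)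
  obtain c where "0 < c" "l \<preceq> c *\<^sub>R u" using order_span_upper[OF l(1)] .
  with l_lower ab have lin: "l \<in> cone_component K u" unfolding cone_component_iff
    by (intro exI[of _ "a / 4"] conjI exI[of _ c]) auto
  have "\<exists>N. \<forall>n\<ge>N. close e (x n) l" if "0 < e" for e
  proof -
    \<comment> \<open>The limit has the weaker lower bound \<open>a / 4\<close>, so that constant is
      used for the terms too.\<close>
    obtain N'' where N'': "near (e * (a / 4)) (x n) l" if "n \<ge> N''" for n
      using l(2) ab(1) \<open>0 < e\<close> unfolding near_tendsto_def
      by (metis divide_pos_pos zero_less_numeral mult_pos_pos)
    have "close e (x n) l" if "n \<ge> max N N''" for n
      by (rule near_imp_close[OF N'' _ l_lower \<open>0 < e\<close>])
        (use that le_trans[OF le_unit_scale lower, of "a / 4"] ab in auto)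
    then show ?thesis by blast
  qed
  then have "converges_wrt (thompson K) x l" using thompson_converges_iff x lin by blast
  then show "\<exists>l\<in>cone_component K u. converges_wrt (thompson K) x l" using lin by blast
qed

section \<open>Monotone Cauchy sequences\<close>

lemma increasing_seq_iff:
  assumes "subspace Z" "\<And>n. x n \<in> Z"
  shows "increasing_seq (K \<inter> Z) x \<longleftrightarrow> (\<forall>m n. m \<le> n \<longrightarrow> x m \<preceq> x n)"
  using assms subspace_diff[OF assms(1)]
  unfolding increasing_seq_def monotone_on_def cone_le_def by auto

lemma cone_le_Int_iff:
  "subspace Z \<Longrightarrow> x \<in> Z \<Longrightarrow> y \<in> Z \<Longrightarrow> cone_le (K \<inter> Z) x y \<longleftrightarrow> x \<preceq> y"
  using subspace_diff[of Z y x] by (auto simp: cone_le_def)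

text \<open>A one-sided estimate against \<open>x k\<close> suffices: for m, n >= k, x m <= x k + e
  u <= x n + e u by monotonicity.\<close>

lemma near_CauchyI_increasing:
  assumes "\<And>m n. m \<le> n \<Longrightarrow> x m \<preceq> x n"
    and "\<And>e. 0 < e \<Longrightarrow> \<exists>k. \<forall>n\<ge>k. x n \<preceq> x k + e *\<^sub>R u"
  shows "near_Cauchy x"
  unfolding near_Cauchy_def
proof (intro allI impI)
  fix e :: real assume "0 < e"
  then obtain k where k: "x n \<preceq> x k + e *\<^sub>R u" if "n \<ge> k" for n using assms(2) by blast
  have "x m \<preceq> x n + e *\<^sub>R u" if "m \<ge> k" "n \<ge> k" for m n
    using k[OF that(1)] le_add_mono[OF assms(1)[OF that(2)] le_refl] by (rule le_trans)
  then show "\<exists>N. \<forall>m\<ge>N. \<forall>n\<ge>N. near e (x m) (x n)" unfolding near_def by blast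
qed

text \<open>The estimate is kept against all later terms and not only the selected ones, so that it
  also controls the full sequence afterwards.\<close>

lemma near_Cauchy_subseq:
  assumes "near_Cauchy x"
  shows "\<exists>r. strict_mono r \<and> (\<forall>k. \<forall>n\<ge>r k. near ((1 / 2) ^ k) (x (r k)) (x n))"
proof -
  have "\<exists>r. \<forall>k. (\<forall>n\<ge>r k. near ((1 / 2) ^ k) (x (r k)) (x n)) \<and> r k < r (Suc k)"
  proof (rule dependent_nat_choice)
    show "\<exists>N. \<forall>n\<ge>N. near ((1 / 2) ^ 0) (x N) (x n)"
      using assms unfolding near_Cauchy_def by (metis order_refl power_0 zero_less_one)
  next
    fix M k
    have "0 < (1 / 2 :: real) ^ Suc k" by simp
    then obtain N where "\<forall>m\<ge>N. \<forall>n\<ge>N. near ((1 / 2) ^ Suc k) (x m) (x n)"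
      using assms unfolding near_Cauchy_def by blast
    then show "\<exists>N. (\<forall>n\<ge>N. near ((1 / 2) ^ Suc k) (x N) (x n)) \<and> M < N"
      by (intro exI[of _ "max N (Suc M)"]) auto
  qed
  then show ?thesis unfolding strict_mono_Suc_iff by blast
qed

lemma half_power_small:
  assumes "0 < e"
  obtains N where "\<And>n. n \<ge> N \<Longrightarrow> (1 / 2 :: real) ^ n < e"
proof -
  obtain N where N: "(1 / 2 :: real) ^ N < e" using real_arch_pow_inv[of e "1 / 2"] assms by auto
  have "(1 / 2 :: real) ^ n < e" if "n \<ge> N" for n
    by (rule le_less_trans[OF power_decreasing[OF that] N]) auto
  then show ?thesis using that by blast
qed

lemma span_mono_completeD:
  assumes span_mono_complete "\<And>n. x n \<in> order_span K u"
    "\<And>m n. m \<le> n \<Longrightarrow> x m \<preceq> x n" "near_Cauchy x"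
  obtains l where "l \<in> order_span K u" "near_tendsto x l"
proof -
  have "range x \<subseteq> order_span K u" "Cauchy_wrt (order_seminorm_dist K u) x"
    using assms seminorm_Cauchy_iff by auto
  moreover have "increasing_seq (order_span_cone K u) x"
    unfolding order_span_cone_def using increasing_seq_iff[OF subspace_order_span] assms by blast
  ultimately obtain l where "l \<in> order_span K u" "converges_wrt (order_seminorm_dist K u) x l"
    using assms(1) unfolding monotonically_sequentially_complete_def by blast
  then show ?thesis using that seminorm_converges_iff assms(2) by blast
qed

lemma span_mono_complete_imp_span_complete:
  assumes span_mono_complete
  shows span_complete
proof (rule span_completeI)
  fix x assume x: "\<And>n. x n \<in> order_span K u" and Cauchy: "near_Cauchy x"
  obtain r :: "nat \<Rightarrow> nat" where r: "strict_mono r"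
    "\<And>k n. n \<ge> r k \<Longrightarrow> near ((1 / 2) ^ k) (x (r k)) (x n)"
    using near_Cauchy_subseq[OF Cauchy] by blast
  \<comment> \<open>The correction shrinks by \<open>(1 / 2) ^ k\<close> from \<open>k\<close> to
    \<open>Suc k\<close>. This offsets the largest decrease that \<open>r\<close> permits between
    the selected terms.\<close>
  define y where "y k = x (r k) + (- (2 * (1 / 2) ^ k)) *\<^sub>R u" for k
  \<comment> \<open>The factor 3 is 2 from the correction plus 1 from the estimate for
    \<open>r\<close>.\<close>
  have near_y: "near (3 * (1 / 2) ^ k) (y k) (x n)" if "n \<ge> r k" for k n
    using near_trans[OF near_shift_unit[of "- (2 * (1 / 2) ^ k)" "2 * (1 / 2) ^ k"] r(2)[OF that]]
    by (simp add: y_def)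
  have step: "y k \<preceq> y (Suc k)" for k
  proof -
    have "r k \<le> r (Suc k)" using r(1) by (simp add: strict_mono_Suc_iff less_imp_le)
    then have "x (r k) \<preceq> x (r (Suc k)) + (1 / 2) ^ k *\<^sub>R u" using r(2) near_def by blast
    moreover have "(2 * (1 / 2) ^ k) *\<^sub>R u = (1 / 2 :: real) ^ k *\<^sub>R u + (1 / 2) ^ k *\<^sub>R u"
      by (simp add: scaleR_2 flip: scaleR_scaleR)
    ultimately show ?thesis by (simp add: y_def cone_le_def algebra_simps)
  qed
  have mono: "y m \<preceq> y n" if "m \<le> n" for m n
    using that by (induction n rule: dec_induct) (auto intro: le_trans step)
  have y: "y k \<in> order_span K u" for k
    using order_span_nearD[OF near_y x] by blast
  have "near_Cauchy y"
  proof (rule near_CauchyI_increasing[OF mono])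
    fix e :: real assume "0 < e"
    \<comment> \<open>Two errors occur below, each at most \<open>3 * (1 / 2) ^ k\<close>, hence the
      sixth.\<close>
    then obtain k where k: "(1 / 2) ^ k < e / 6"
      using half_power_small[of "e / 6"] by auto
    have "near e (y n) (y k)" if "n \<ge> k" for n
    proof -
      have "r k \<le> r n" using r(1) that by (simp add: strict_mono_less_eq)
      then have "near (3 * (1 / 2) ^ n + 3 * (1 / 2) ^ k) (y n) (y k)"
        using near_trans[OF near_y[of n "r n"]] near_y[of k "r n"] near_sym by blast
      moreover have "(1 / 2 :: real) ^ n \<le> (1 / 2) ^ k"
        by (rule power_decreasing[OF that]) auto
      ultimately show ?thesis using k by (elim near_mono) linarith
    qed
    then show "\<exists>k. \<forall>n\<ge>k. y n \<preceq> y k + e *\<^sub>R u" unfolding near_def by blast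
  qed
  then obtain l where l: "near_tendsto y l"
    using span_mono_completeD[where x = y, OF assms y mono] by blast
  have "near_tendsto x l"
    unfolding near_tendsto_def
  proof (intro allI impI)
    fix e :: real assume "0 < e"
    then obtain N where N: "near (e / 2) (y n) l" if "n \<ge> N" for n
      using l unfolding near_tendsto_def by (metis half_gt_zero)
    obtain N' where N': "(1 / 2) ^ n < e / 6" if "n \<ge> N'" for n
      using half_power_small[of "e / 6"] \<open>0 < e\<close> by auto
    define k where "k = max N N'"
    have "near e (x n) l" if "n \<ge> r k" for n
    proof (rule near_mono)
      show "near (3 * (1 / 2) ^ k + e / 2) (x n) l"
        using near_trans[of _ "x n" "y k" "e / 2" l] near_y[OF that] N[of k] near_sym
        by (simp add: k_def)
      show "3 * (1 / 2) ^ k + e / 2 \<le> e"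
        using N'[of k] by (simp add: k_def)
    qed
    then show "\<exists>N. \<forall>n\<ge>N. near e (x n) l" by blast
  qed
  then show "\<exists>l. near_tendsto x l" by blast
qed

lemma span_complete_imp_span_mono_complete: "span_complete \<Longrightarrow> span_mono_complete"
  unfolding complete_wrt_def monotonically_sequentially_complete_def by blast

text \<open>For \<open>n\<close> past the Cauchy index, x n + e u lies in the span and bounds the
  whole sequence from above, so the least upper bound cannot exceed it.\<close>

lemma is_sup_imp_near_tendsto:
  assumes "is_sup_in (order_span K u) (order_span_cone K u) (range x) s"
    and x: "\<And>n. x n \<in> order_span K u" and mono: "\<And>m n. m \<le> n \<Longrightarrow> x m \<preceq> x n"
    and "near_Cauchy x"
  shows "near_tendsto x s"
  unfolding near_tendsto_def
proof (intro allI impI)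
  note [simp] = cone_le_Int_iff[OF subspace_order_span] x
  have s: "s \<in> order_span K u" using assms(1) by (simp add: is_sup_in_def)
  have ub: "x n \<preceq> s" for n
    using assms(1) s by (auto simp: is_sup_in_def order_span_cone_def)
  have least: "s \<preceq> b" if "b \<in> order_span K u" "\<And>n. x n \<preceq> b" for b
    using assms(1) s that by (auto simp: is_sup_in_def order_span_cone_def)
  fix e :: real assume "0 < e"
  then obtain N where N: "near e (x m) (x n)" if "m \<ge> N" "n \<ge> N" for m n
    using assms(4) unfolding near_Cauchy_def by blast
  have "near e (x n) s" if "n \<ge> N" for n
    unfolding near_def
  proof
    show "x n \<preceq> s + e *\<^sub>R u"
      using le_add_mono[OF ub[of n] le_unit_scale[of 0 e]] \<open>0 < e\<close> by simp
    show "s \<preceq> x n + e *\<^sub>R u"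
    proof (rule least)
      show "x n + e *\<^sub>R u \<in> order_span K u"
        using subspace_order_span by (simp add: subspace_add subspace_scale unit_in_order_span)
      fix m
      have "x m \<preceq> x (max m n)" by (rule mono) simp
      also have "x (max m n) \<preceq> x n + e *\<^sub>R u"
        using N[of "max m n" n] that by (simp add: near_def)
      finally show "x m \<preceq> x n + e *\<^sub>R u" .
    qed
  qed
  then show "\<exists>N. \<forall>n\<ge>N. near e (x n) s" by blast
qed

lemma span_sigma_complete_imp_span_mono_complete:
  assumes span_sigma_complete
  shows span_mono_complete
  unfolding monotonically_sequentially_complete_def
proof (intro allI impI)
  fix x assume A: "range x \<subseteq> order_span K u \<and> increasing_seq (order_span_cone K u) x \<and>
    Cauchy_wrt (order_seminorm_dist K u) x"
  then obtain s where s: "is_sup_in (order_span K u) (order_span_cone K u) (range x) s"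
    using assms unfolding fundamentally_sigma_order_complete_def by blast
  have x: "x n \<in> order_span K u" for n using A by auto
  have "near_tendsto x s"
  proof (rule is_sup_imp_near_tendsto[OF s x])
    show "x m \<preceq> x n" if "m \<le> n" for m n
      using A that increasing_seq_iff[where x = x, OF subspace_order_span x] by (simp add: order_span_cone_def)
    show "near_Cauchy x" using A seminorm_Cauchy_iff[where x = x, OF x] by blast
  qed
  moreover have "s \<in> order_span K u" using s by (simp add: is_sup_in_def)
  ultimately show "\<exists>l\<in>order_span K u. converges_wrt (order_seminorm_dist K u) x l"
    using seminorm_converges_iff x by blast
qed

end

section \<open>Self-completeness in an Archimedean subspace\<close>

locale archimedean_subspace = pointed_cone +
  fixes Z :: "'a set"
  assumes subspace: "subspace Z" and span_subset: "order_span K u \<subseteq> Z"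
    and archimedean: "archimedean_in Z (K \<inter> Z)"
begin

lemma span_in: "x \<in> order_span K u \<Longrightarrow> x \<in> Z"
  using span_subset by blast

lemmas cone_le_Z = cone_le_Int_iff[OF subspace]

text \<open>Taking \<open>e = 1 / real n\<close> and multiplying by \<open>n\<close> gives n (x - y)
  <= u for all positive \<open>n\<close>, to which the Archimedean property applies.\<close>

lemma archimedean_le:
  assumes "x \<in> Z" "y \<in> Z" "\<And>e. 0 < e \<Longrightarrow> x \<preceq> y + e *\<^sub>R u"
  shows "x \<preceq> y"
proof -
  have xy: "x - y \<in> Z" and zero: "0 \<in> Z" and u: "u \<in> Z"
    using assms subspace_diff subspace_0 subspace span_in unit_in_order_span by auto
  have "real n *\<^sub>R (x - y) \<preceq> u" for n
  proof (cases "n = 0")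
    case True
    then show ?thesis using unit_nonneg by simp
  next
    case False
    then have "x - y \<preceq> (1 / real n) *\<^sub>R u" using assms(3)[of "1 / real n"] by (simp add: le_diff_iff)
    from le_scale_mono[OF _ this, of "real n"] False show ?thesis by simp
  qed
  then have "cone_le (K \<inter> Z) (real n *\<^sub>R (x - y)) u" for n
    using cone_le_Z xy u subspace_scale[OF subspace] by blast
  then have "cone_le (K \<inter> Z) (x - y) 0"
    using archimedean xy u unfolding archimedean_in_def by blast
  then show ?thesis using cone_le_Z[OF xy zero] by (simp add: cone_le_def)
qed

text \<open>Arbitrarily late terms are close to \<open>l\<close>, so both inequalities hold up to e
  u for every \<open>e\<close>, and \<open>archimedean_le\<close> removes the error. Upper bounds
  range over all of \<open>Z\<close>, which may exceed the span.\<close>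

lemma near_tendsto_imp_is_sup:
  assumes "near_tendsto x l" "l \<in> Z" and x: "\<And>n. x n \<in> Z"
    and mono: "\<And>m n. m \<le> n \<Longrightarrow> x m \<preceq> x n"
  shows "is_sup_in Z (K \<inter> Z) (range x) l"
proof -
  have lim: "\<exists>k. k \<ge> n \<and> near e (x k) l" if "0 < e" for e n
    using assms(1) that unfolding near_tendsto_def by (metis max.cobounded1 max.cobounded2)
  have "x n \<preceq> l" for n
  proof (rule archimedean_le[OF x assms(2)])
    fix e :: real assume "0 < e"
    then obtain k where "k \<ge> n" "near e (x k) l" using lim by blast
    then show "x n \<preceq> l + e *\<^sub>R u" using le_trans[OF mono] by (auto simp: near_def)
  qed
  moreover have "l \<preceq> b" if "b \<in> Z" "\<And>n. x n \<preceq> b" for b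
  proof (rule archimedean_le[OF assms(2) that(1)])
    fix e :: real assume "0 < e"
    then obtain k where "near e (x k) l" using lim by blast
    then show "l \<preceq> b + e *\<^sub>R u"
      using le_trans[OF _ le_add_mono[OF that(2) le_refl]] by (auto simp: near_def)
  qed
  ultimately show ?thesis
    using assms(2) x by (auto simp: is_sup_in_def cone_le_Z)
qed

lemma self_complete_order_span_coneI:
  assumes span_mono_complete
  shows "self_complete_in Z (K \<inter> Z) (order_span_cone K u)"
  unfolding self_complete_in_def
proof (intro conjI allI impI)
  fix x
  assume A: "range x \<subseteq> order_span_cone K u \<and> increasing_seq (K \<inter> Z) x \<and> self_bounded (K \<inter> Z) x"
  then have "x n \<in> order_span_cone K u" for n by auto
  then have x: "x n \<in> order_span K u" "0 \<preceq> x n" "x n \<in> Z" for n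
    using order_span_cone_in_span order_span_cone_nonneg span_in by blast+
  have mono: "x m \<preceq> x n" if "m \<le> n" for m n
    using A that increasing_seq_iff[where x = x, OF subspace x(3)] by blast
  have self: "\<exists>k. \<forall>n\<ge>k. x n \<preceq> t *\<^sub>R x k" if "1 < t" for t
    using A that x cone_le_Z subspace_scale[OF subspace]
    unfolding self_bounded_def upper_self_bounded_def by metis
  \<comment> \<open>The factor 2 bounds the tail by one multiple of \<open>u\<close>, and
    monotonicity then bounds the earlier terms.\<close>
  obtain k where k: "x n \<preceq> 2 *\<^sub>R x k" if "n \<ge> k" for n using self[of 2] by auto
  obtain b where b: "0 < b" "2 *\<^sub>R x k \<preceq> b *\<^sub>R u"
    using order_span_upper subspace_scale[OF subspace_order_span] x(1) by metis
  have bound: "x n \<preceq> b *\<^sub>R u" for n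
  proof -
    have "x n \<preceq> x (max n k)" by (rule mono) simp
    also have "x (max n k) \<preceq> 2 *\<^sub>R x k" by (rule k) simp
    also note b(2)
    finally show ?thesis .
  qed
  have "near_Cauchy x"
  proof (rule near_CauchyI_increasing[OF mono])
    fix e :: real assume "0 < e"
    \<comment> \<open>The relative excess \<open>e / b\<close> costs at most e u, because every term
      is below b u.\<close>
    then obtain j where j: "x n \<preceq> (1 + e / b) *\<^sub>R x j" if "n \<ge> j" for n
      using self[of "1 + e / b"] b by auto
    have "x n \<preceq> x j + e *\<^sub>R u" if "n \<ge> j" for n
    proof -
      have "x j + (e / b) *\<^sub>R x j \<preceq> x j + (e / b) *\<^sub>R (b *\<^sub>R u)"
        using \<open>0 < e\<close> b by (intro le_add_mono le_scale_mono bound) auto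
      with j[OF that] show ?thesis
        using b by (auto simp: scaleR_add_left intro: le_trans)
    qed
    then show "\<exists>k. \<forall>n\<ge>k. x n \<preceq> x k + e *\<^sub>R u" by blast
  qed
  then obtain l where l: "l \<in> order_span K u" "near_tendsto x l"
    using span_mono_completeD[where x = x, OF assms x(1) mono] by blast
  then have sup: "is_sup_in Z (K \<inter> Z) (range x) l"
    using near_tendsto_imp_is_sup span_in x(3) mono by blast
  then have "x 0 \<preceq> l" using l(1) x(3) by (auto simp: is_sup_in_def cone_le_Z)
  then have "0 \<preceq> l" using le_trans[OF x(2)] by blast
  with sup l(1) show "\<exists>s\<in>order_span_cone K u. is_sup_in Z (K \<inter> Z) (range x) s"
    by (auto simp: order_span_cone_def in_cone_iff)
next
  fix x
  assume A: "range x \<subseteq> order_span_cone K u \<and> decreasing_seq (K \<inter> Z) x \<and> self_bounded (K \<inter> Z) x"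
  then have "x n \<in> order_span_cone K u" for n by auto
  then have x: "x n \<in> order_span K u" "0 \<preceq> x n" "x n \<in> Z" for n
    using order_span_cone_in_span order_span_cone_nonneg span_in by blast+
  have neg: "- x n \<in> order_span K u" "- x n \<in> Z" for n
    using x subspace_neg subspace subspace_order_span by blast+
  have mono: "- x m \<preceq> - x n" if "m \<le> n" for m n
    using A that cone_le_Z x(3) unfolding decreasing_seq_def monotone_on_def
    by (simp add: cone_le_def)
  have self: "\<exists>k. \<forall>n\<ge>k. t *\<^sub>R x k \<preceq> x n" if "0 < t" "t < 1" for t
    using A that x cone_le_Z subspace_scale[OF subspace]
    unfolding self_bounded_def lower_self_bounded_def by metis
  obtain b where b: "0 < b" "x 0 \<preceq> b *\<^sub>R u"
    using order_span_upper x(1) by metis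
  have bound: "x n \<preceq> b *\<^sub>R u" for n
    using mono[of 0 n] b(2) le_trans[of "x n" "x 0"] by (simp add: cone_le_def)
  have "near_Cauchy (\<lambda>n. - x n)"
  proof (rule near_CauchyI_increasing[OF mono])
    fix e :: real assume "0 < e"
    \<comment> \<open>The minimum keeps \<open>1 - t\<close> admissible for lower self-boundedness
      while the loss t b stays below \<open>e\<close>.\<close>
    define t where "t = min (e / b) (1 / 2)"
    have t: "0 < t" "t < 1" "t * b \<le> e" using \<open>0 < e\<close> b(1) by (auto simp: t_def min_def field_simps)
    then obtain j where j: "(1 - t) *\<^sub>R x j \<preceq> x n" if "n \<ge> j" for n
      using self[of "1 - t"] by auto
    have "- x n \<preceq> - x j + e *\<^sub>R u" if "n \<ge> j" for n
    proof -
      have "t *\<^sub>R x j \<preceq> t *\<^sub>R (b *\<^sub>R u)" using t by (intro le_scale_mono bound) auto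
      also have "t *\<^sub>R (b *\<^sub>R u) \<preceq> e *\<^sub>R u" using t(3) by (simp add: le_unit_scale)
      finally have "(1 - t) *\<^sub>R x j + t *\<^sub>R x j \<preceq> x n + e *\<^sub>R u" using j[OF that] le_add_mono by blast
      then show ?thesis by (simp add: cone_le_def algebra_simps)
    qed
    then show "\<exists>k. \<forall>n\<ge>k. - x n \<preceq> - x k + e *\<^sub>R u" by blast
  qed
  then obtain l where l: "l \<in> order_span K u" "near_tendsto (\<lambda>n. - x n) l"
    using span_mono_completeD[where x = "\<lambda>n. - x n", OF assms neg(1) mono] by blast
  then have sup: "is_sup_in Z (K \<inter> Z) (range (\<lambda>n. - x n)) l"
    using near_tendsto_imp_is_sup span_in neg(2) mono by blast
  \<comment> \<open>Zero bounds the negatives from above, so their supremum \<open>l\<close> is at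
    most 0 and \<open>- l\<close> lies in the cone.\<close>
  have "- x n \<preceq> 0" for n
    using x(2)[of n] by (simp add: cone_le_def)
  then have "cone_le (K \<inter> Z) (- x n) 0" for n
    using cone_le_Z neg(2) subspace_0[OF subspace] by blast
  then have "cone_le (K \<inter> Z) l 0"
    using sup subspace_0[OF subspace] unfolding is_sup_in_def by blast
  then have "0 \<preceq> - l" using l(1) span_in subspace_0[OF subspace]
    by (simp add: cone_le_Z) (simp add: cone_le_def)
  moreover have "- l \<in> order_span K u" using l(1) subspace_neg subspace_order_span by blast
  moreover have "is_inf_in Z (K \<inter> Z) (range x) (- l)"
    using sup by (simp add: is_inf_in_iff_is_sup_in_uminus[OF subspace])
  ultimately show "\<exists>s\<in>order_span_cone K u. is_inf_in Z (K \<inter> Z) (range x) s"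
    by (auto simp: order_span_cone_def in_cone_iff)
qed

text \<open>A supremum dominates \<open>x 0\<close> and so stays in the component. An infimum could
  leave it; lower self-boundedness with constant 1/2 supplies half of some term as a lower
  bound.\<close>

lemma self_complete_cone_componentI:
  assumes "self_complete_in Z (K \<inter> Z) (order_span_cone K u)"
  shows "self_complete_in Z (K \<inter> Z) (cone_component K u)"
  unfolding self_complete_in_def
proof (intro conjI allI impI)
  fix x
  assume A: "range x \<subseteq> cone_component K u \<and> increasing_seq (K \<inter> Z) x \<and> self_bounded (K \<inter> Z) x"
  then have x: "x n \<in> cone_component K u" for n by auto
  obtain s where s: "s \<in> order_span_cone K u" "is_sup_in Z (K \<inter> Z) (range x) s"
    using assms A cone_component_subset unfolding self_complete_in_def by (metis subset_trans)
  have "x 0 \<preceq> s"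
    using s x span_in cone_component_in_span by (auto simp: is_sup_in_def cone_le_Z)
  then have "s \<in> cone_component K u"
    using order_span_lower_in_component[of s 1 "x 0"] s(1) x order_span_cone_in_span by simp
  with s(2) show "\<exists>s\<in>cone_component K u. is_sup_in Z (K \<inter> Z) (range x) s" by blast
next
  fix x
  assume A: "range x \<subseteq> cone_component K u \<and> decreasing_seq (K \<inter> Z) x \<and> self_bounded (K \<inter> Z) x"
  then have x: "x n \<in> cone_component K u" for n by auto
  then have xZ: "x n \<in> Z" for n using span_in cone_component_in_span by blast
  obtain s where s: "s \<in> order_span_cone K u" "is_inf_in Z (K \<inter> Z) (range x) s"
    using assms A cone_component_subset unfolding self_complete_in_def by (metis subset_trans)
  have half: "(1 / 2) *\<^sub>R x k \<in> Z" for k by (rule subspace_scale[OF subspace xZ])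
  have "\<exists>k. \<forall>n\<ge>k. cone_le (K \<inter> Z) ((1 / 2) *\<^sub>R x k) (x n)"
    using A unfolding self_bounded_def lower_self_bounded_def
    by (metis half_gt_zero zero_less_one field_sum_of_halves less_add_same_cancel1)
  then obtain k where k: "(1 / 2) *\<^sub>R x k \<preceq> x n" if "n \<ge> k" for n
    using cone_le_Z half xZ by blast
  have "(1 / 2) *\<^sub>R x k \<preceq> x n" for n
  proof -
    have "(1 / 2) *\<^sub>R x k \<preceq> x (max k n)" by (rule k) simp
    also have "x (max k n) \<preceq> x n"
      using A cone_le_Z xZ unfolding decreasing_seq_def monotone_on_def by auto
    finally show ?thesis .
  qed
  then have "cone_le (K \<inter> Z) ((1 / 2) *\<^sub>R x k) s"
    using s(2) half xZ by (auto simp: is_inf_in_def cone_le_Z)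
  then have "(1 / 2) *\<^sub>R x k \<preceq> s"
    using s(2) half cone_le_Z unfolding is_inf_in_def by blast
  then have "s \<in> cone_component K u"
    using order_span_lower_in_component[of s "1 / 2" "x k"] s(1) x order_span_cone_in_span by simp
  with s(2) show "\<exists>s\<in>cone_component K u. is_inf_in Z (K \<inter> Z) (range x) s" by blast
qed

lemma self_complete_imp_span_sigma_complete:
  assumes "self_complete_in Z (K \<inter> Z) (cone_component K u)"
  shows span_sigma_complete
  unfolding fundamentally_sigma_order_complete_def
proof (intro allI impI)
  fix x assume A: "range x \<subseteq> order_span K u \<and> increasing_seq (order_span_cone K u) x \<and>
    Cauchy_wrt (order_seminorm_dist K u) x"
  then have x: "x n \<in> order_span K u" for n by auto
  have Cauchy: "near_Cauchy x" using A seminorm_Cauchy_iff[where x = x, OF x] by blast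
  have mono: "x m \<preceq> x n" if "m \<le> n" for m n
    using A that increasing_seq_iff[where x = x, OF subspace_order_span x] by (simp add: order_span_cone_def)
  \<comment> \<open>The translation sends \<open>x 0\<close> to \<open>u\<close>, so all translated
    terms lie above \<open>u\<close>.\<close>
  define c where "c = u - x 0"
  have c: "c \<in> order_span K u"
    unfolding c_def by (rule subspace_diff[OF subspace_order_span unit_in_order_span x])
  define y where "y n = x n + c" for n
  have y_span: "y n \<in> order_span K u" for n
    unfolding y_def by (rule subspace_add[OF subspace_order_span x c])
  have y_mono: "y m \<preceq> y n" if "m \<le> n" for m n
    using mono[OF that] by (simp add: y_def cone_le_def)
  have lower: "u \<preceq> y n" for n
    using mono[of 0 n] by (simp add: y_def c_def cone_le_def)
  have nonneg: "0 \<preceq> y n" for n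
    using le_trans[OF unit_nonneg lower] .
  have y: "y n \<in> cone_component K u" for n
    using order_span_upper[OF y_span[of n]] lower[of n] unfolding cone_component_iff
    by (metis scaleR_one zero_less_one)
  have yZ: "y n \<in> Z" for n using span_in y_span by blast
  have "upper_self_bounded (K \<inter> Z) y"
    unfolding upper_self_bounded_def
  proof (intro allI impI)
    fix t :: real assume "1 < t"
    then obtain N where N: "near (t - 1) (x m) (x n)" if "m \<ge> N" "n \<ge> N" for m n
      using Cauchy unfolding near_Cauchy_def by (metis diff_gt_0_iff_gt)
    \<comment> \<open>Because \<open>u\<close> is a lower bound, an absolute error
      \<open>t - 1\<close> is also a relative one, giving the factor \<open>t\<close>.\<close>
    have "y n \<preceq> t *\<^sub>R y N" if "n \<ge> N" for n
      using near_imp_close[of "t - 1" 1 "y n" "y N"] N[OF that] lower \<open>1 < t\<close>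
      by (simp add: y_def near_iff_add close_def)
    then show "\<exists>k. \<forall>n\<ge>k. cone_le (K \<inter> Z) (y n) (t *\<^sub>R y k)"
      using cone_le_Z yZ subspace_scale[OF subspace] by blast
  qed
  moreover have "lower_self_bounded (K \<inter> Z) y"
    unfolding lower_self_bounded_def
  proof (intro allI impI)
    fix t :: real assume "0 < t \<and> t < 1"
    \<comment> \<open>For an increasing nonnegative sequence the index 0 serves every
      \<open>t\<close>.\<close>
    then have "t *\<^sub>R y 0 \<preceq> y n" for n
      using le_scale_right[OF _ nonneg[of 0], of t 1] y_mono[of 0 n] by (auto intro: le_trans)
    then show "\<exists>k. \<forall>n\<ge>k. cone_le (K \<inter> Z) (t *\<^sub>R y k) (y n)"
      using cone_le_Z yZ subspace_scale[OF subspace] by blast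
  qed
  moreover have "increasing_seq (K \<inter> Z) y"
    using increasing_seq_iff[where x = y, OF subspace yZ] y_mono by blast
  ultimately obtain s where s: "s \<in> cone_component K u" "is_sup_in Z (K \<inter> Z) (range y) s"
    using assms y unfolding self_complete_in_def self_bounded_def by (metis image_subsetI)
  have s_span: "s \<in> order_span K u" using s(1) cone_component_in_span by blast
  \<comment> \<open>A supremum in \<open>Z\<close> that lies in the span is also one in the span:
    fewer competing upper bounds remain. Translating back by \<open>c\<close> preserves it.\<close>
  have "is_sup_in (order_span K u) (order_span_cone K u) (range x) (s - c)"
    unfolding is_sup_in_def
  proof (intro conjI ballI impI)
    show sc: "s - c \<in> order_span K u" by (rule subspace_diff[OF subspace_order_span s_span c])
    note [simp] = cone_le_Int_iff[OF subspace_order_span]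
    show "cone_le (order_span_cone K u) z (s - c)" if z: "z \<in> range x" for z
    proof -
      obtain n where n: "z = x n" using z by blast
      have "y n \<preceq> s" using s yZ by (auto simp: is_sup_in_def cone_le_Z)
      then have "x n \<preceq> s - c" by (simp add: y_def cone_le_def algebra_simps)
      then show ?thesis using sc x n by (simp add: order_span_cone_def)
    qed
    show "cone_le (order_span_cone K u) (s - c) b"
      if b: "b \<in> order_span K u" "\<forall>z\<in>range x. cone_le (order_span_cone K u) z b" for b
    proof -
      have "x n \<preceq> b" for n using b x by (simp add: order_span_cone_def)
      then have "y n \<preceq> b + c" for n by (simp add: y_def cone_le_def)
      moreover have "b + c \<in> Z" using subspace_add[OF subspace] b(1) c span_in by blast
      ultimately have "s \<preceq> b + c" using s(2) yZ s_span span_in by (auto simp: is_sup_in_def cone_le_Z)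
      then have "s - c \<preceq> b" by (simp add: cone_le_def algebra_simps)
      then show ?thesis using sc b(1) by (simp add: order_span_cone_def)
    qed
  qed
  then show "\<exists>s. is_sup_in (order_span K u) (order_span_cone K u) (range x) s" by blast
qed

text \<open>The implications form a cycle in which only the self-completeness assertions depend on
  \<open>Z\<close>; hence they have the same strength for every admissible \<open>Z\<close>.\<close>

lemma component_complete_iff:
  "component_complete \<longleftrightarrow> self_complete_in Z (K \<inter> Z) (cone_component K u)"
  "component_complete \<longleftrightarrow> self_complete_in Z (K \<inter> Z) (order_span_cone K u)"
  using component_complete_imp_span_complete span_complete_imp_component_complete
    span_complete_imp_span_mono_complete span_mono_complete_imp_span_complete
    span_sigma_complete_imp_span_mono_complete self_complete_order_span_coneI
    self_complete_cone_componentI self_complete_imp_span_sigma_complete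
  by blast+

end

theorem theorem4p14:
  fixes K :: "'a::real_vector set" and u :: 'a
  assumes "ordering_cone K"
    and "u \<in> K - {0}"
    and "archimedean_in (order_span K u) (order_span_cone K u)"
  shows
    "((complete_wrt (thompson K) (cone_component K u)
        \<longleftrightarrow> self_complete_in (order_span K u) (order_span_cone K u) (cone_component K u)) \<and>
      (complete_wrt (thompson K) (cone_component K u)
        \<longleftrightarrow> self_complete_in (order_span K u) (order_span_cone K u) (order_span_cone K u)) \<and>
      (complete_wrt (thompson K) (cone_component K u)
        \<longleftrightarrow> fundamentally_sigma_order_complete
              (order_span K u) (order_span_cone K u) (order_seminorm_dist K u)) \<and>
      (complete_wrt (thompson K) (cone_component K u)
        \<longleftrightarrow> monotonically_sequentially_complete
              (order_span K u) (order_span_cone K u) (order_seminorm_dist K u)) \<and>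
      (complete_wrt (thompson K) (cone_component K u)
        \<longleftrightarrow> complete_wrt (order_seminorm_dist K u) (order_span K u)))
     \<and>
     (archimedean_in UNIV K \<longrightarrow>
       (complete_wrt (thompson K) (cone_component K u)
         \<longleftrightarrow> self_complete_in UNIV K (cone_component K u)) \<and>
       (complete_wrt (thompson K) (cone_component K u)
         \<longleftrightarrow> self_complete_in UNIV K (order_span_cone K u)))"
proof -
  interpret pointed_cone K u
    using assms by unfold_locales auto
  interpret span: archimedean_subspace K u "order_span K u"
    using assms(3) subspace_order_span by unfold_locales (auto simp: order_span_cone_def)
  note span_iff = span.component_complete_iff[folded order_span_cone_def]
  \<comment> \<open>Limits become suprema by way of self-completeness, with the span itself as
    \<open>Z\<close>.\<close>
  have sigma: "span_mono_complete \<Longrightarrow> span_sigma_complete"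
    using span.self_complete_order_span_coneI span.self_complete_cone_componentI
      span.self_complete_imp_span_sigma_complete by blast
  have "component_complete \<longleftrightarrow> self_complete_in UNIV K (cone_component K u)"
    "component_complete \<longleftrightarrow> self_complete_in UNIV K (order_span_cone K u)"
    if "archimedean_in UNIV K"
  proof -
    \<comment> \<open>With \<open>Z\<close> the whole space, the cone \<open>K \<inter> UNIV\<close>
      is \<open>K\<close>, which gives the stronger versions.\<close>
    interpret whole: archimedean_subspace K u UNIV
      using that by unfold_locales auto
    show "component_complete \<longleftrightarrow> self_complete_in UNIV K (cone_component K u)"
      "component_complete \<longleftrightarrow> self_complete_in UNIV K (order_span_cone K u)"
      using whole.component_complete_iff by simp_all
  qed
  then show ?thesis
    using span_iff sigma component_complete_imp_span_complete span_complete_imp_component_complete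
      span_complete_imp_span_mono_complete span_mono_complete_imp_span_complete
      span_sigma_complete_imp_span_mono_complete
    by blast
qed

end
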